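(* Let $\mathbb{A}$ be a finite non-empty set and let $\preceq$ be a total order on $\mathbb{A}^{\mathbb{N}}$ such that for each $n\in\mathbb{N}$ and all $u,v\in\mathbb{A}^n$, if $u^\omega\prec v^\omega$ then $ux\prec vy$ for all $x,y\in\mathbb{A}^{\mathbb{N}}$. Let $x\in\mathbb{A}^{\mathbb{N}}$. Then $x\notin\mathcal{L}_\omega$ if and only if either $x=l^\omega$ for some finite word $l\in\mathcal{L}_\omega$, or only a finite number of (finite) prefixes of $x$ are members of $\mathcal{L}_\omega$.
   Context: $\mathbb{N}=\{1,2,3,\ldots\}$; $\mathbb{A}^+=\bigcup_{n\in\mathbb{N}}\mathbb{A}^n$ is the set of non-empty finite words over $\mathbb{A}$, and $\mathbb{A}^{\mathbb{N}}$ is the set of right infinite words. For $w\in\mathbb{A}^+$, $w^\omega=www\cdots\in\mathbb{A}^{\mathbb{N}}$. $x\prec y$ means $x\preceq y$ and $x\ne y$. A proper suffix of a finite word $w$ is a word $v\in\mathbb{A}^+$ with $w=uv$ for some $u\in\mathbb{A}^+$; a proper suffix of an infinite word $x$ is a $y\in\mathbb{A}^{\mathbb{N}}$ with $x=uy$ for some $u\in\mathbb{A}^+$ (so $y=x$ is possible when $x$ is periodic). An infinite word $x\in\mathbb{A}^{\mathbb{N}}$ is $\omega$-Lyndon if $x\prec y$ for each proper suffix $y$ of $x$. A finite word $w\in\mathbb{A}^+$ is $\omega$-Lyndon if $w^\omega\prec v^\omega$ for each proper suffix $v$ of $w$. $\mathcal{L}_\omega$ denotes the set of all finite and infinite $\omega$-Lyndon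 words. *)

theory Defs
  imports Main "HOL-Library.Omega_Words_Fun"
begin

text \<open>
  An order on infinite words is a relation \<open>r\<close>, where \<open>(x, y) \<in> r\<close> stands for \<open>x \<preceq> y\<close>.
\<close>

definition strictly_below :: "'a word rel \<Rightarrow> 'a word \<Rightarrow> 'a word \<Rightarrow> bool" where
  "strictly_below r x y \<longleftrightarrow> (x, y) \<in> r \<and> x \<noteq> y"

definition proper_suffix_fin :: "'a list \<Rightarrow> 'a list \<Rightarrow> bool" where
  "proper_suffix_fin v w \<longleftrightarrow> v \<noteq> [] \<and> (\<exists>u. u \<noteq> [] \<and> w = u @ v)"

text \<open>
  A periodic infinite word is a proper suffix of itself.
\<close>

definition proper_suffix_inf :: "'a word \<Rightarrow> 'a word \<Rightarrow> bool" where
  "proper_suffix_inf y x \<longleftrightarrow> (\<exists>u. u \<noteq> [] \<and> x = u \<frown> y)"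

definition omega_Lyndon_fin :: "'a word rel \<Rightarrow> 'a list \<Rightarrow> bool" where
  "omega_Lyndon_fin r w \<longleftrightarrow>
     w \<noteq> [] \<and> (\<forall>v. proper_suffix_fin v w \<longrightarrow> strictly_below r (w\<^sup>\<omega>) (v\<^sup>\<omega>))"

definition omega_Lyndon_inf :: "'a word rel \<Rightarrow> 'a word \<Rightarrow> bool" where
  "omega_Lyndon_inf r x \<longleftrightarrow> (\<forall>y. proper_suffix_inf y x \<longrightarrow> strictly_below r x y)"

text \<open>
  The set of all finite (\<open>Inl\<close>) and infinite (\<open>Inr\<close>) \<open>\<omega>\<close>-Lyndon words.
\<close>

definition omega_Lyndon :: "'a word rel \<Rightarrow> ('a list + 'a word) set" where
  "omega_Lyndon r = Inl ` {w. omega_Lyndon_fin r w} \<union> Inr ` {x. omega_Lyndon_inf r x}"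

end

theory Submission
  imports Defs
begin

text \<open>
  The hypothesis says that two distinct infinite words are compared by looking only at any pair of
  prefixes of equal length that differ. The words \<open>u\<^sup>\<omega>\<close> and \<open>v\<^sup>\<omega>\<close> differ where \<open>uv\<close> and \<open>vu\<close>
  do; hence \<open>u\<^sup>\<omega> \<prec> v\<^sup>\<omega>\<close> gives \<open>(uv)\<^sup>\<omega> \<prec> v\<^sup>\<omega>\<close>, and also \<open>u v\<^sup>\<omega> \<prec> v\<^sup>\<omega>\<close>.

  Let \<open>x\<close> be \<open>\<omega>\<close>-Lyndon with only finitely many \<open>\<omega>\<close>-Lyndon prefixes. For each \<open>n\<close>, let \<open>V n\<close> be
  the shortest among the suffixes \<open>v\<close> of the prefix of length \<open>n\<close> of \<open>x\<close> for which \<open>v\<^sup>\<omega>\<close> is least.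
  It is \<open>\<omega>\<close>-Lyndon and, as \<open>x\<close> is below its proper suffixes, also a prefix of \<open>x\<close>, so \<open>V\<close> takes
  finitely many values. Cutting off \<open>V n = l\<close> leaves a prefix whose value is not below \<open>l\<close>. So if
  \<open>l\<close> is the greatest value taken infinitely often, then arbitrarily high powers of \<open>l\<close> occur in \<open>x\<close>.
  But \<open>l\<^sup>\<omega> \<prec> x\<close>, so a suffix of \<open>x\<close> that starts with a high power of \<open>l\<close> is below \<open>x\<close>.

  Conversely, if \<open>x\<close> has \<open>\<omega>\<close>-Lyndon prefixes of unbounded length, then no suffix of \<open>x\<close> is strictly
  below \<open>x\<close>. So \<open>x\<close> can only fail to be \<open>\<omega>\<close>-Lyndon by being periodic, and the shortest \<open>l\<close> with
  \<open>x = l\<^sup>\<omega>\<close> is \<open>\<omega>\<close>-Lyndon.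
\<close>

section \<open>Periodic words\<close>

lemma conc_iter: "u \<noteq> [] \<Longrightarrow> u \<frown> u\<^sup>\<omega> = u\<^sup>\<omega>"
  by (metis iter_unroll length_greater_0_conv)

lemma prefix_iter:
  assumes "n \<le> length w"
  shows "prefix n (w\<^sup>\<omega>) = take n w"
proof (cases "w = []")
  case True
  then show ?thesis using assms by simp
next
  case False
  then show ?thesis using assms by (metis conc_iter prefix_conc_fst)
qed

lemma word_neqE:
  assumes "x \<noteq> y"
  obtains n where "prefix n x \<noteq> prefix n y"
proof -
  obtain i where "x i \<noteq> y i" using assms by auto
  then have "prefix (Suc i) x \<noteq> prefix (Suc i) y" by simp
  then show ?thesis using that by blast
qed

lemma iter_unique:
  assumes "x = u \<frown> x" "u \<noteq> []"
  shows "x = u\<^sup>\<omega>"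
proof
  fix n
  show "x n = (u\<^sup>\<omega>) n"
  proof (induction n rule: less_induct)
    case (less n)
    show ?case
    proof (cases "n < length u")
      case True
      then have "x n = u ! n" by (subst assms(1)) simp
      then show ?thesis using True assms(2) by simp
    next
      case False
      then have "x n = x (n - length u)" by (subst assms(1)) simp
      also have "\<dots> = (u\<^sup>\<omega>) (n - length u)"
        using False assms(2) by (intro less diff_less) (cases n; simp)+
      also have "\<dots> = (u\<^sup>\<omega>) n" using False assms(2) by (simp add: le_mod_geq)
      finally show ?thesis .
    qed
  qed
qed

lemma iter_power:
  assumes "u \<noteq> []"
  shows "concat (replicate m u) \<frown> u\<^sup>\<omega> = u\<^sup>\<omega>"
proof (induction m)
  case (Suc m)
  have "concat (replicate (Suc m) u) \<frown> u\<^sup>\<omega> = u \<frown> concat (replicate m u) \<frown> u\<^sup>\<omega>" by simp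
  also have "\<dots> = u\<^sup>\<omega>" unfolding Suc using assms by (rule conc_iter)
  finally show ?case .
qed simp

lemma iter_eq_if_commute:
  assumes "u @ v = v @ u" "u \<noteq> []" "v \<noteq> []"
  shows "u\<^sup>\<omega> = v\<^sup>\<omega>"
proof -
  have "u \<frown> v\<^sup>\<omega> = u \<frown> v \<frown> v\<^sup>\<omega>" using assms(3) by (simp add: conc_iter del: conc_conc)
  also have "\<dots> = v \<frown> (u \<frown> v\<^sup>\<omega>)" using assms(1) by simp
  finally have "u \<frown> v\<^sup>\<omega> = v\<^sup>\<omega>" using assms(3) by (rule iter_unique)
  then show ?thesis using assms(2) iter_unique by metis
qed

text \<open>As in Euclid's algorithm, a common initial part is stripped: if
  \<open>v = u @ r\<close>, then \<open>u @ v\<close> and \<open>v @ u\<close> are \<open>u\<close>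
  followed by \<open>u @ r\<close> and \<open>r @ u\<close>, so the length found for
  \<open>u\<close> and \<open>r\<close> only grows by \<open>length u\<close>.\<close>

lemma iter_diff:
  assumes "u \<noteq> []" "v \<noteq> []" "u @ v \<noteq> v @ u"
  shows "\<exists>n. prefix n (u\<^sup>\<omega>) \<noteq> prefix n (v\<^sup>\<omega>) \<and>
    (\<forall>y. prefix n ((u @ v) \<frown> y) = prefix n (u\<^sup>\<omega>)) \<and>
    (\<forall>y. prefix n ((v @ u) \<frown> y) = prefix n (v\<^sup>\<omega>))"
  (is "\<exists>n. ?P n u v")
  using assms
proof (induction "length u + length v" arbitrary: u v rule: less_induct)
  case less
  have step: "\<exists>n. ?P n u (u @ r)"
    if ne: "u \<noteq> []" "r \<noteq> []" and ncomm: "u @ r \<noteq> r @ u"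
      and IH: "\<exists>n. ?P n u r" for u r :: "'a list"
  proof -
    from IH obtain n where n: "?P n u r" by blast
    have shift: "prefix (length u + n) (u \<frown> z) = u @ prefix n z" for z :: "'a word"
      by simp
    have uw: "prefix (length u + n) (u\<^sup>\<omega>) = u @ prefix n (u\<^sup>\<omega>)"
      using conc_iter[OF ne(1)] shift[of "u\<^sup>\<omega>"] by simp
    have "u \<frown> (r @ u) \<frown> (r \<frown> (u @ r)\<^sup>\<omega>) = (u @ r) \<frown> (u @ r) \<frown> (u @ r)\<^sup>\<omega>"
      by simp
    also have "\<dots> = (u @ r)\<^sup>\<omega>" using ne by (simp add: conc_iter del: conc_conc)
    finally have "(u @ r)\<^sup>\<omega> = u \<frown> (r @ u) \<frown> (r \<frown> (u @ r)\<^sup>\<omega>)" ..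
    then have vw: "prefix (length u + n) ((u @ r)\<^sup>\<omega>) = u @ prefix n (r\<^sup>\<omega>)"
      using shift n by metis
    have 1: "prefix (length u + n) ((u @ u @ r) \<frown> y) = u @ prefix n (u\<^sup>\<omega>)" for y
      using shift[of "(u @ r) \<frown> y"] n by simp
    have 2: "prefix (length u + n) (((u @ r) @ u) \<frown> y) = u @ prefix n (r\<^sup>\<omega>)" for y
      using shift[of "(r @ u) \<frown> y"] n by simp
    have "?P (length u + n) u (u @ r)"
      using n unfolding uw vw 1 2 by simp
    then show ?thesis by blast
  qed
  consider r where "v = u @ r" | r where "u = v @ r"
    | "take (length u) v \<noteq> u" "take (length v) u \<noteq> v"
    by (metis append_take_drop_id)
  then show ?case
  proof cases
    case (1 r)
    with less.prems have "r \<noteq> []" "u @ r \<noteq> r @ u" by auto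
    then have "\<exists>n. ?P n u (u @ r)"
      using less.prems(1) 1 by (intro step less.hyps) auto
    then show ?thesis using 1 by simp
  next
    case (2 r)
    with less.prems have r: "r \<noteq> []" "v @ r \<noteq> r @ v" by auto
    then have "\<exists>n. ?P n v (v @ r)"
      using less.prems(2) 2 by (intro step less.hyps) auto
    then obtain n where "?P n v u" using 2 by blast
    then have "?P n u v" by metis
    then show ?thesis by blast
  next
    case 3
    define n where "n = min (length u) (length v)"
    have n: "n \<le> length u" "n \<le> length v" by (simp_all add: n_def)
    have "take n u \<noteq> take n v" using 3 by (auto simp: n_def min_def split: if_splits)
    then have "?P n u v" using n by (simp add: prefix_iter)
    then show ?thesis by blast
  qed
qed

section \<open>Orders that are determined by prefixes\<close>

locale word_order =
  fixes r :: "'a word rel"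
  assumes linear: "linear_order r"
    and below_conc: "\<And>n u v y z. n \<ge> 1 \<Longrightarrow> length u = n \<Longrightarrow> length v = n \<Longrightarrow>
      strictly_below r (u\<^sup>\<omega>) (v\<^sup>\<omega>) \<Longrightarrow> strictly_below r (u \<frown> y) (v \<frown> z)"
begin

abbreviation below (infix "\<prec>" 50) where "x \<prec> y \<equiv> strictly_below r x y"

lemma below_irrefl [simp]: "\<not> x \<prec> x"
  by (simp add: strictly_below_def)

lemma below_trans: "x \<prec> y \<Longrightarrow> y \<prec> z \<Longrightarrow> x \<prec> z"
  using linear unfolding strictly_below_def order_on_defs
  by (metis antisymD transD)

lemma below_linear: "x \<prec> y \<or> x = y \<or> y \<prec> x"
  using linear unfolding strictly_below_def order_on_defs total_on_def by auto

text \<open>The powers of the two prefixes are distinct, hence comparable. The wrong direction would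
  give \<open>y \<prec> x\<close> by \<open>below_conc\<close>; the right one carries over to all
  continuations.\<close>

lemma below_prefix:
  assumes "x \<prec> y" "prefix n x \<noteq> prefix n y"
    and "prefix n x' = prefix n x" "prefix n y' = prefix n y"
  shows "x' \<prec> y'"
proof -
  define u where "u = prefix n x"
  define v where "v = prefix n y"
  have uv: "u \<noteq> v" "length u = n" "length v = n" using assms by (auto simp: u_def v_def)
  then have n: "n \<ge> 1" by (cases n) auto
  have split: "x = u \<frown> suffix n x" "y = v \<frown> suffix n y"
    "x' = u \<frown> suffix n x'" "y' = v \<frown> suffix n y'"
    unfolding u_def v_def by (simp, simp, simp flip: assms(3), simp flip: assms(4))
  have "prefix n (u\<^sup>\<omega>) \<noteq> prefix n (v\<^sup>\<omega>)" using uv by (simp add: prefix_iter)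
  then have "u\<^sup>\<omega> \<noteq> v\<^sup>\<omega>" by auto
  moreover have "\<not> v\<^sup>\<omega> \<prec> u\<^sup>\<omega>"
    using below_conc[OF n uv(3,2)] split(1,2) assms(1) below_trans below_irrefl by metis
  ultimately have "u\<^sup>\<omega> \<prec> v\<^sup>\<omega>" using below_linear by blast
  from below_conc[OF n uv(2,3) this] show ?thesis using split(3,4) by metis
qed

text \<open>By \<open>iter_diff\<close>, \<open>(u @ v) \<frown> y\<close> agrees with
  \<open>u\<^sup>\<omega>\<close> up to a length at which \<open>u\<^sup>\<omega>\<close> and
  \<open>v\<^sup>\<omega>\<close> already differ.\<close>

lemma iter_below_append:
  assumes "u \<noteq> []" "v \<noteq> []" "u\<^sup>\<omega> \<prec> v\<^sup>\<omega>"
  shows "(u @ v) \<frown> y \<prec> v\<^sup>\<omega>"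
proof -
  have "u @ v \<noteq> v @ u" using assms iter_eq_if_commute by fastforce
  then show ?thesis using iter_diff[OF assms(1,2)] below_prefix[OF assms(3)] by blast
qed

lemma iter_append_below:
  assumes "u \<noteq> []" "v \<noteq> []" "u\<^sup>\<omega> \<prec> v\<^sup>\<omega>"
  shows "(u @ v)\<^sup>\<omega> \<prec> v\<^sup>\<omega>"
  using iter_below_append[OF assms, of "(u @ v)\<^sup>\<omega>"] conc_iter[of "u @ v"] assms by simp

section \<open>Finite \<open>\<omega>\<close>-Lyndon words\<close>

text \<open>If \<open>v = u @ s\<close> with \<open>s\<close> non-empty, then \<open>u\<close>
  commutes with \<open>v\<close>, hence with \<open>s\<close>, and \<open>s\<close> has the same
  power as \<open>v\<close>. This contradicts that \<open>v\<close> is \<omega>-Lyndon.\<close>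

lemma Lyndon_iter_inj_aux:
  assumes "omega_Lyndon_fin r v" "u \<noteq> []" "u\<^sup>\<omega> = v\<^sup>\<omega>" "length u \<le> length v"
  shows "u = v"
proof (rule ccontr)
  assume "u \<noteq> v"
  have "take (length u) v = u"
    using assms(3,4) prefix_iter[of "length u" v] prefix_iter[of "length u" u] by simp
  then obtain s where v: "v = u @ s" by (metis append_take_drop_id)
  with \<open>u \<noteq> v\<close> have s: "s \<noteq> []" by auto
  have "u @ v = v @ u" using iter_diff[of u v] assms(2,3) v by auto
  then have "u\<^sup>\<omega> = s\<^sup>\<omega>" using v s assms(2) by (intro iter_eq_if_commute) auto
  moreover have "v\<^sup>\<omega> \<prec> s\<^sup>\<omega>"
    using assms(1,2) v s unfolding omega_Lyndon_fin_def proper_suffix_fin_def by blast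
  ultimately show False using assms(3) by simp
qed

lemma Lyndon_iter_inj:
  assumes "omega_Lyndon_fin r u" "omega_Lyndon_fin r v" "u\<^sup>\<omega> = v\<^sup>\<omega>"
  shows "u = v"
  using Lyndon_iter_inj_aux[of v u] Lyndon_iter_inj_aux[of u v] assms
  by (metis nat_le_linear omega_Lyndon_fin_def)

text \<open>Requiring \<open>omega_Lyndon_fin\<close> selects the shortest of the suffixes with
  least power: proper suffixes of \<open>v\<close> have a strictly greater one.\<close>

definition min_suffix :: "'a list \<Rightarrow> 'a list \<Rightarrow> bool" where
  "min_suffix v w \<longleftrightarrow> omega_Lyndon_fin r v \<and> (\<exists>u. w = u @ v) \<and>
     (\<forall>u s. w = u @ s \<longrightarrow> s \<noteq> [] \<longrightarrow> \<not> s\<^sup>\<omega> \<prec> v\<^sup>\<omega>)"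

text \<open>Prepending a letter adds one candidate, the whole word; it replaces the old suffix only
  if its power is strictly below.\<close>

lemma min_suffix_exists: "w \<noteq> [] \<Longrightarrow> \<exists>v. min_suffix v w"
proof (induction w)
  case (Cons a w)
  show ?case
  proof (cases "w = []")
    case True
    then have "min_suffix [a] (a # w)"
      unfolding min_suffix_def omega_Lyndon_fin_def proper_suffix_fin_def
      by (auto simp: Cons_eq_append_conv)
    then show ?thesis by blast
  next
    case False
    with Cons obtain v where v: "min_suffix v w" by blast
    show ?thesis
    proof (cases "(a # w)\<^sup>\<omega> \<prec> v\<^sup>\<omega>")
      case True
      have le: "(a # w)\<^sup>\<omega> \<prec> s\<^sup>\<omega>" if "s \<noteq> []" "w = t @ s" for s t
        using v that True below_linear[of "s\<^sup>\<omega>" "v\<^sup>\<omega>"] below_trans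
        unfolding min_suffix_def by metis
      have "omega_Lyndon_fin r (a # w)"
        using le unfolding omega_Lyndon_fin_def proper_suffix_fin_def
        by (auto simp: Cons_eq_append_conv)
      moreover have "\<not> s\<^sup>\<omega> \<prec> (a # w)\<^sup>\<omega>" if "a # w = u @ s" "s \<noteq> []" for u s
        using that le below_trans below_irrefl by (metis Cons_eq_append_conv)
      ultimately have "min_suffix (a # w) (a # w)" unfolding min_suffix_def by auto
      then show ?thesis by blast
    next
      case False
      have "min_suffix v (a # w)"
        using v False unfolding min_suffix_def
        by (metis Cons_eq_append_conv append_Cons)
      then show ?thesis by blast
    qed
  qed
qed simp

text \<open>Otherwise \<open>v' @ v\<close> would be a suffix of \<open>w @ v\<close> with a power
  below that of \<open>v\<close>.\<close>

lemma min_suffix_antimono: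
  assumes "min_suffix v (w @ v)" "min_suffix v' w"
  shows "\<not> v'\<^sup>\<omega> \<prec> v\<^sup>\<omega>"
proof
  assume less: "v'\<^sup>\<omega> \<prec> v\<^sup>\<omega>"
  have ne: "v \<noteq> []" "v' \<noteq> []"
    using assms unfolding min_suffix_def omega_Lyndon_fin_def by auto
  obtain u where "w = u @ v'" using assms(2) unfolding min_suffix_def by blast
  then have "w @ v = u @ (v' @ v)" by simp
  then have "\<not> (v' @ v)\<^sup>\<omega> \<prec> v\<^sup>\<omega>" using assms(1) ne unfolding min_suffix_def by blast
  then show False using iter_append_below[OF ne(2,1) less] by simp
qed

lemma exists_maximal_iter:
  assumes "finite S" "S \<noteq> {}"
  shows "\<exists>m\<in>S. \<forall>s\<in>S. \<not> m\<^sup>\<omega> \<prec> s\<^sup>\<omega>"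
  using assms
proof (induction S rule: finite_ne_induct)
  case (insert a S)
  then obtain m where m: "m \<in> S" "\<forall>s\<in>S. \<not> m\<^sup>\<omega> \<prec> s\<^sup>\<omega>" by blast
  show ?case
  proof (cases "m\<^sup>\<omega> \<prec> a\<^sup>\<omega>")
    case True
    then have "\<forall>s\<in>insert a S. \<not> a\<^sup>\<omega> \<prec> s\<^sup>\<omega>" using m below_trans by auto
    then show ?thesis by blast
  qed (use m in auto)
qed simp

section \<open>Infinite \<open>\<omega>\<close>-Lyndon words\<close>

lemma Lyndon_inf_not_iter:
  assumes "omega_Lyndon_inf r x" "l \<noteq> []"
  shows "x \<noteq> l\<^sup>\<omega>"
proof
  assume "x = l\<^sup>\<omega>"
  then have "x = l \<frown> x" using conc_iter assms(2) by metis
  then have "x \<prec> x"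
    using assms unfolding omega_Lyndon_inf_def proper_suffix_inf_def by blast
  then show False by simp
qed

text \<open>Otherwise \<open>x \<prec> z\<close>, for the suffix \<open>z\<close> of
  \<open>x\<close> starting with this \<open>v\<close>, is decided within the first
  \<open>length v\<close> letters, so the power of the whole prefix is below that of
  \<open>v\<close>.\<close>

lemma min_suffix_prefix:
  assumes "omega_Lyndon_inf r x" "min_suffix v (prefix n x)"
  shows "prefix (length v) x = v"
proof (rule ccontr)
  assume neq: "prefix (length v) x \<noteq> v"
  obtain u where u: "prefix n x = u @ v" using assms(2) unfolding min_suffix_def by blast
  then have n: "n = length u + length v"
    by (metis length_append subsequence_length diff_zero)
  have v: "v \<noteq> []" using assms(2) unfolding min_suffix_def omega_Lyndon_fin_def by blast
  have "u \<noteq> []" using u n neq by auto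
  define z where "z = v \<frown> suffix n x"
  have "x = u \<frown> z" using u prefix_suffix[of x n] unfolding z_def by simp
  then have "x \<prec> z"
    using assms(1) \<open>u \<noteq> []\<close> unfolding omega_Lyndon_inf_def proper_suffix_inf_def by blast
  moreover have z: "prefix (length v) z = v" unfolding z_def by simp
  moreover have "prefix (length v) (v\<^sup>\<omega>) = v" by (simp add: prefix_iter)
  moreover have "prefix (length v) ((prefix n x)\<^sup>\<omega>) = prefix (length v) x"
    using n by (simp add: prefix_iter min_absorb1)
  ultimately have "(prefix n x)\<^sup>\<omega> \<prec> v\<^sup>\<omega>"
    using below_prefix[of x z "length v"] neq by metis
  moreover have "prefix n x \<noteq> []" using u v by simp
  ultimately show False using assms(2) unfolding min_suffix_def by (metis append_Nil)
qed

text \<open>Were \<open>x \<prec> l\<^sup>\<omega>\<close>, long prefixes of \<open>x\<close> would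
  have powers below \<open>l\<^sup>\<omega>\<close> too, against the minimality of \<open>l\<close>
  in them. Equality fails as \<open>x\<close> is not periodic.\<close>

lemma infinite_min_suffix_iter_below:
  assumes "omega_Lyndon_inf r x" "infinite {n. min_suffix l (prefix n x)}"
  shows "l\<^sup>\<omega> \<prec> x"
proof -
  obtain n where "min_suffix l (prefix n x)"
    using assms(2) by (metis Collect_empty_eq finite.emptyI)
  then have "l \<noteq> []" unfolding min_suffix_def omega_Lyndon_fin_def by blast
  moreover have "\<not> x \<prec> l\<^sup>\<omega>"
  proof
    assume less: "x \<prec> l\<^sup>\<omega>"
    then have "x \<noteq> l\<^sup>\<omega>" by auto
    then obtain k where k: "prefix k x \<noteq> prefix k (l\<^sup>\<omega>)" by (rule word_neqE)
    obtain n where n: "n > k" "min_suffix l (prefix n x)"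
      using assms(2) unfolding infinite_nat_iff_unbounded by blast
    have "prefix k ((prefix n x)\<^sup>\<omega>) = prefix k x"
      using n by (simp add: prefix_iter min_absorb1)
    then have "(prefix n x)\<^sup>\<omega> \<prec> l\<^sup>\<omega>" using below_prefix[OF less k] by blast
    moreover have "prefix n x \<noteq> []" using n(1) by simp
    ultimately show False using n(2) unfolding min_suffix_def by (metis append_Nil)
  qed
  ultimately show ?thesis using below_linear Lyndon_inf_not_iter[OF assms(1)] by metis
qed

lemma infinite_Lyndon_prefixes:
  assumes x: "omega_Lyndon_inf r x"
  shows "infinite {w. (\<exists>y. x = w \<frown> y) \<and> omega_Lyndon_fin r w}" (is "infinite ?L")
proof
  assume fin: "finite ?L"
  have "\<exists>v. min_suffix v (prefix n x)" if "n > 0" for n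
    using that by (intro min_suffix_exists) simp
  then obtain V where V: "\<And>n. n > 0 \<Longrightarrow> min_suffix (V n) (prefix n x)" by metis
  have VL: "V n \<in> ?L" if "n > 0" for n
  proof -
    have "x = V n \<frown> suffix (length (V n)) x"
      using min_suffix_prefix[OF x V[OF that]] prefix_suffix by metis
    then show ?thesis using V[OF that] unfolding min_suffix_def by blast
  qed
  define A where "A l = {n. n > 0 \<and> V n = l}" for l
  define S where "S = {l \<in> ?L. infinite (A l)}"
  have finS: "finite S" using fin unfolding S_def by (rule rev_finite_subset) blast
  \<comment> \<open>Finitely many values, each taken finitely often: past some \<open>B\<close> only
    values in \<open>S\<close> occur.\<close>
  have "finite (\<Union>l\<in>?L - S. A l)" using fin unfolding S_def by auto
  then obtain B where B: "\<And>n. n \<in> (\<Union>l\<in>?L - S. A l) \<Longrightarrow> n \<le> B"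
    unfolding finite_nat_set_iff_bounded_le by blast
  have VS: "V n \<in> S" if "n > B" for n
    using B[of n] VL[of n] that unfolding A_def by auto
  then have "S \<noteq> {}" by blast
  then obtain l where l: "l \<in> S" "\<And>s. s \<in> S \<Longrightarrow> \<not> l\<^sup>\<omega> \<prec> s\<^sup>\<omega>"
    using exists_maximal_iter[OF finS] by blast
  have lL: "omega_Lyndon_fin r l" and infA: "infinite (A l)" using l(1) unfolding S_def by auto
  then have ne: "l \<noteq> []" unfolding omega_Lyndon_fin_def by blast

  have strip: "prefix n x = prefix (n - length l) x @ l \<and> V (n - length l) = l"
    if n: "n > B + length l" "V n = l" for n
  proof -
    let ?m = "n - length l"
    have min: "min_suffix l (prefix n x)" using V[of n] n by simp
    then obtain u where u: "prefix n x = u @ l" unfolding min_suffix_def by blast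
    have "u = take ?m (prefix n x)"
      unfolding u using n(1) u by (metis append_eq_conv_conj diff_add_inverse2 diff_zero
          length_append subsequence_length)
    then have um: "u = prefix ?m x" by (simp add: min_absorb1)
    have m: "min_suffix (V ?m) (prefix ?m x)" "V ?m \<in> S" using V VS n(1) by simp_all
    \<comment> \<open>\<open>min_suffix_antimono\<close> rules out a value below \<open>l\<close>,
      maximality of \<open>l\<close> one above it, and an \<omega>-Lyndon word is determined by its
      power.\<close>
    then have "\<not> (V ?m)\<^sup>\<omega> \<prec> l\<^sup>\<omega>" using min_suffix_antimono min u um by metis
    then have "(V ?m)\<^sup>\<omega> = l\<^sup>\<omega>" using below_linear l(2)[OF m(2)] by blast
    then have "V ?m = l" using Lyndon_iter_inj lL m(1) unfolding min_suffix_def by blast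
    then show ?thesis using u um by simp
  qed
  \<comment> \<open>Each cut shortens the prefix by \<open>length l\<close>. The bound keeps all
    lengths above \<open>B\<close>, so the remaining \<open>u\<close> is non-empty.\<close>
  have power: "\<exists>u. u \<noteq> [] \<and> prefix n x = u @ concat (replicate M l)"
    if "n > B + M * length l" "V n = l" for n M
    using that
  proof (induction M arbitrary: n)
    case 0
    then show ?case by auto
  next
    case (Suc M)
    then have b: "prefix n x = prefix (n - length l) x @ l" "V (n - length l) = l"
      using strip[of n] by auto
    have "n - length l > B + M * length l" using Suc.prems(1) by simp
    from Suc.IH[OF this b(2)]
    obtain u where "u \<noteq> []" "prefix (n - length l) x = u @ concat (replicate M l)" by blast
    moreover have "concat (replicate M l) @ l = concat (replicate (Suc M) l)"
      by (simp flip: replicate_append_same)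
    ultimately show ?case using b(1) by auto
  qed

  have "A l \<subseteq> {n. min_suffix l (prefix n x)}" unfolding A_def using V by auto
  then have "infinite {n. min_suffix l (prefix n x)}" using infA finite_subset by blast
  then have less: "l\<^sup>\<omega> \<prec> x" by (rule infinite_min_suffix_iter_below[OF x])
  then have "l\<^sup>\<omega> \<noteq> x" by auto
  then obtain k where k: "prefix k (l\<^sup>\<omega>) \<noteq> prefix k x" by (rule word_neqE)
  \<comment> \<open>\<open>k\<close> copies cover the first \<open>k\<close> letters, as
    \<open>l\<close> has at least one.\<close>
  let ?p = "concat (replicate k l)"
  obtain n where "n > B + k * length l" "V n = l"
    using infA unfolding infinite_nat_iff_unbounded A_def by blast
  then obtain u where u: "u \<noteq> []" "prefix n x = u @ ?p" using power by blast
  then have "x = u \<frown> (?p \<frown> suffix n x)" using prefix_suffix[of x n] by simp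
  then have "x \<prec> ?p \<frown> suffix n x"
    using x u(1) unfolding omega_Lyndon_inf_def proper_suffix_inf_def by blast
  moreover have "?p \<frown> suffix n x \<prec> x"
  proof (rule below_prefix[OF less k])
    have "k \<le> length ?p" using ne by (simp add: length_concat sum_list_replicate Suc_le_eq)
    then show "prefix k (?p \<frown> suffix n x) = prefix k (l\<^sup>\<omega>)"
      using iter_power[OF ne, of k] by (metis prefix_conc_fst)
  qed simp
  ultimately show False using below_trans below_irrefl by blast
qed

text \<open>A long \<omega>-Lyndon prefix \<open>w = u @ s\<close> has
  \<open>w\<^sup>\<omega> \<prec> s\<^sup>\<omega>\<close>, but \<open>s\<close> and
  \<open>w\<close> begin with the first \<open>k\<close> letters of \<open>y\<close> and
  \<open>x\<close>, which force the opposite.\<close>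

lemma infinite_Lyndon_prefixes_suffix:
  assumes inf: "infinite {w. (\<exists>y. x = w \<frown> y) \<and> omega_Lyndon_fin r w}"
    and y: "proper_suffix_inf y x"
  shows "\<not> y \<prec> x"
proof
  assume less: "y \<prec> x"
  obtain u where u: "u \<noteq> []" "x = u \<frown> y" using y unfolding proper_suffix_inf_def by blast
  from less have "y \<noteq> x" by auto
  then obtain k where k: "prefix k y \<noteq> prefix k x" by (rule word_neqE)
  then have "k > 0" by (cases k) auto
  let ?W = "{w. (\<exists>y. x = w \<frown> y) \<and> omega_Lyndon_fin r w}"
  have "\<exists>w\<in>?W. length w \<ge> length u + k"
  proof (rule ccontr)
    assume "\<not> ?thesis"
    then have "?W \<subseteq> (\<lambda>n. prefix n x) ` {..<length u + k}"
      by (force simp: image_iff not_le)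
    then show False using inf finite_subset by blast
  qed
  then obtain w z where "x = w \<frown> z" and w: "omega_Lyndon_fin r w" "length w \<ge> length u + k"
    by blast
  then have wx: "prefix (length w) x = w" by simp
  define s where "s = prefix (length w - length u) y"
  have ws: "w = u @ s" using w(2) wx u(2) unfolding s_def by (metis add_leD1 prefix_conc_snd)
  have s: "k \<le> length s" using w(2) unfolding s_def by simp
  then have "s \<noteq> []" using \<open>k > 0\<close> by auto
  then have "w\<^sup>\<omega> \<prec> s\<^sup>\<omega>"
    using w(1) u(1) ws unfolding omega_Lyndon_fin_def proper_suffix_fin_def by blast
  moreover have "s\<^sup>\<omega> \<prec> w\<^sup>\<omega>"
  proof (rule below_prefix[OF less k])
    show "prefix k (s\<^sup>\<omega>) = prefix k y"
      using s unfolding s_def by (simp add: prefix_iter min_absorb1)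
    have "k \<le> length w" using w(2) by simp
    then show "prefix k (w\<^sup>\<omega>) = prefix k x"
      by (subst wx[symmetric]) (simp add: prefix_iter min_absorb1)
  qed
  ultimately show False using below_trans below_irrefl by blast
qed

lemma infinite_Lyndon_prefixes_iter:
  assumes inf: "infinite {w. (\<exists>y. x = w \<frown> y) \<and> omega_Lyndon_fin r w}"
    and x: "\<not> omega_Lyndon_inf r x"
  shows "\<exists>l. omega_Lyndon_fin r l \<and> x = l\<^sup>\<omega>"
proof -
  obtain y where "proper_suffix_inf y x" "\<not> x \<prec> y"
    using x unfolding omega_Lyndon_inf_def by blast
  moreover from this have "y = x"
    using infinite_Lyndon_prefixes_suffix[OF inf] below_linear by blast
  ultimately obtain u where "u \<noteq> []" "x = u \<frown> x" unfolding proper_suffix_inf_def by blast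
  then have "u \<noteq> [] \<and> x = u\<^sup>\<omega>" using iter_unique by blast
  \<comment> \<open>With the shortest period, no proper suffix of \<open>l\<close> has the same
    power as \<open>l\<close>.\<close>
  then obtain l where l: "l \<noteq> []" "x = l\<^sup>\<omega>"
    and least: "\<And>v. v \<noteq> [] \<and> x = v\<^sup>\<omega> \<Longrightarrow> length l \<le> length v"
    using ex_has_least_nat[of "\<lambda>v. v \<noteq> [] \<and> x = v\<^sup>\<omega>" u length] by blast
  have "l\<^sup>\<omega> \<prec> g\<^sup>\<omega>" if g: "g \<noteq> []" "f \<noteq> []" "l = f @ g" for f g
  proof -
    have "l\<^sup>\<omega> \<noteq> g\<^sup>\<omega>" using least[of g] g l(2) by auto
    moreover have "\<not> g\<^sup>\<omega> \<prec> l\<^sup>\<omega>"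
    proof
      assume "g\<^sup>\<omega> \<prec> l\<^sup>\<omega>"
      \<comment> \<open>As \<open>l\<^sup>\<omega>\<close> absorbs \<open>l\<close>, this puts the
        suffix \<open>g \<frown> x\<close> of \<open>x\<close> below \<open>x\<close>.\<close>
      then have "(g @ l) \<frown> l\<^sup>\<omega> \<prec> l\<^sup>\<omega>" using iter_below_append g(1) l(1) by blast
      moreover have "g \<frown> l\<^sup>\<omega> = (g @ l) \<frown> l\<^sup>\<omega>"
        using l(1) by (simp add: conc_iter flip: conc_conc)
      ultimately have "g \<frown> x \<prec> x" using l(2) by simp
      moreover have "x = f \<frown> (g \<frown> x)"
        using conc_iter[OF l(1)] l(2) g(3) by simp
      then have "proper_suffix_inf (g \<frown> x) x"
        using g(2) unfolding proper_suffix_inf_def by blast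
      ultimately show False using infinite_Lyndon_prefixes_suffix[OF inf] by blast
    qed
    ultimately show ?thesis using below_linear by blast
  qed
  then have "omega_Lyndon_fin r l"
    using l(1) unfolding omega_Lyndon_fin_def proper_suffix_fin_def by blast
  then show ?thesis using l(2) by blast
qed

end

theorem lemma2p5:
  fixes r :: "('a::finite) word rel" and x :: "'a word"
  assumes "linear_order r"
    and "\<And>n u v y z. n \<ge> 1 \<Longrightarrow> length u = n \<Longrightarrow> length v = n \<Longrightarrow>
           strictly_below r (u\<^sup>\<omega>) (v\<^sup>\<omega>) \<Longrightarrow> strictly_below r (u \<frown> y) (v \<frown> z)"
  shows "Inr x \<notin> omega_Lyndon r \<longleftrightarrow>
           (\<exists>l. Inl l \<in> omega_Lyndon r \<and> x = l\<^sup>\<omega>) \<or>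
           finite {w. (\<exists>y. x = w \<frown> y) \<and> Inl w \<in> omega_Lyndon r}"
proof -
  interpret word_order r by unfold_locales (fact assms)+
  have mem: "Inl w \<in> omega_Lyndon r \<longleftrightarrow> omega_Lyndon_fin r w"
    "Inr z \<in> omega_Lyndon r \<longleftrightarrow> omega_Lyndon_inf r z" for w z
    by (auto simp: omega_Lyndon_def)
  have "\<not> omega_Lyndon_inf r x" if "omega_Lyndon_fin r l" "x = l\<^sup>\<omega>" for l
    using that Lyndon_inf_not_iter unfolding omega_Lyndon_fin_def by blast
  then show ?thesis
    unfolding mem using infinite_Lyndon_prefixes infinite_Lyndon_prefixes_iter by blast
qed

end
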